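(* Let $n\ge 2$ be an integer and let $N$ be an integer with $N \ge \frac74 n+10$. Then $P_N^3\to(\mathcal{C}_{\le 5},P_n)$; that is, for every red/blue coloring of the edges of $P_N^3$ with no red cycle of length $3$, $4$ or $5$, there is a blue path on at least $n$ vertices.
   Context: $P_N$ denotes the path on $N$ vertices and $P_N^3$ its third power: the graph on vertex set $[N]=\{1,\dots,N\}$ in which $i$ and $j$ are adjacent iff $1\le |i-j|\le 3$. For a family of graphs $\mathcal{F}$ and a graph $H$, $G\to(\mathcal{F},H)$ means every red/blue coloring of $E(G)$ contains a red copy of some member of $\mathcal{F}$ or a blue copy of $H$. $\mathcal{C}_{\le m}$ denotes the family of all cycles of length at most $m$. *)

theory Defs
  imports Complex_Main
begin

definition P3_edge :: "nat \<Rightarrow> nat \<Rightarrow> nat \<Rightarrow> bool" where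
  "P3_edge N i j \<longleftrightarrow> i \<in> {1..N} \<and> j \<in> {1..N} \<and> i \<noteq> j \<and> i \<le> j + 3 \<and> j \<le> i + 3"

text \<open>A red/blue colouring is a predicate red on 2-element vertex sets {i,j};
  an edge is blue iff it is not red.\<close>

definition red_cycle :: "nat \<Rightarrow> (nat set \<Rightarrow> bool) \<Rightarrow> nat \<Rightarrow> bool" where
  "red_cycle N red k \<longleftrightarrow> 3 \<le> k \<and> (\<exists>vs. length vs = k \<and> distinct vs \<and>
     (\<forall>i<k. P3_edge N (vs!i) (vs!((i+1) mod k)) \<and> red {vs!i, vs!((i+1) mod k)}))"

definition blue_path :: "nat \<Rightarrow> (nat set \<Rightarrow> bool) \<Rightarrow> nat \<Rightarrow> bool" where
  "blue_path N red n \<longleftrightarrow> (\<exists>vs. length vs = n \<and> distinct vs \<and>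
     (\<forall>i. i + 1 < n \<longrightarrow> P3_edge N (vs!i) (vs!(i+1)) \<and> \<not> red {vs!i, vs!(i+1)}))"

definition arrows_short_cycles_path :: "nat \<Rightarrow> nat \<Rightarrow> nat \<Rightarrow> bool" where
  "arrows_short_cycles_path N m n \<longleftrightarrow>
     (\<forall>red. (\<exists>k\<in>{3..m}. red_cycle N red k) \<or> blue_path N red n)"

end

theory Submission
  imports Defs
begin

text \<open>
  Sweep the vertices from left to right, keeping two blue paths inside \<open>{1..x + 1}\<close>, one ending
  at \<open>x\<close> and one ending at \<open>x + 1\<close>. The path ending at \<open>x + 1\<close> has density about \<open>4/7\<close>, and the
  other one is shorter by one vertex, or by two vertices if the density is better by a fixed amount.
  From either situation, however the edges among \<open>x, \<dots>, x + 6\<close> are coloured without a red cycle of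
  length at most \<open>5\<close>, one of these situations recurs at some \<open>x + k\<close> with \<open>k \<le> 5\<close>. This claim
  concerns seven vertices only, and the finite list of extensions that suffices was found by
  computer search.
\<close>

text \<open>Pairing \<open>vs\<close> with \<open>rotate1 vs\<close> lists the edges of the closed
  walk, so that for a concrete list simplification works edge by edge, with no indices modulo the
  length.\<close>

lemma short_cycle_not_red:
  assumes "\<forall>k\<in>{3..5}. \<not> red_cycle N red k"
    and "length vs \<in> {3..5}" "distinct vs"
    and "list_all (\<lambda>(i, j). P3_edge N i j) (zip vs (rotate1 vs))"
  shows "\<not> list_all (\<lambda>(i, j). red {i, j}) (zip vs (rotate1 vs))"
proof
  assume "list_all (\<lambda>(i, j). red {i, j}) (zip vs (rotate1 vs))"
  with assms(2-4) have "red_cycle N red (length vs)"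
    by (auto simp: red_cycle_def list_all_length nth_rotate1 intro!: exI[of _ vs])
  with assms(1,2) show False by blast
qed

section \<open>Blue paths with a prescribed last vertex\<close>

definition blue :: "(nat set \<Rightarrow> bool) \<Rightarrow> nat \<Rightarrow> nat \<Rightarrow> bool" where
  "blue red i j \<longleftrightarrow> i \<le> j + 3 \<and> j \<le> i + 3 \<and> \<not> red {i, j}"

text \<open>The bound \<open>p\<close> makes every vertex beyond \<open>p\<close> fresh for an
  extension. As \<open>l\<close> is only a lower bound, surplus vertices may go uncounted.\<close>

definition blue_end :: "(nat set \<Rightarrow> bool) \<Rightarrow> nat \<Rightarrow> nat \<Rightarrow> nat \<Rightarrow> bool" where
  "blue_end red p v l \<longleftrightarrow> (\<exists>vs. vs \<noteq> [] \<and> last vs = v \<and> l \<le> length vs \<and> distinct vs \<and>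
     set vs \<subseteq> {1..p} \<and> successively (blue red) vs)"

lemma blue_end_extend:
  assumes "blue_end red p v l" "successively (blue red) (v # ws)" "distinct ws"
    and "set ws \<subseteq> {p<..q}" "p \<le> q" "last (v # ws) = w" "l' \<le> l + length ws"
  shows "blue_end red q w l'"
proof -
  from assms(1) obtain vs where vs: "vs \<noteq> []" "last vs = v" "l \<le> length vs" "distinct vs"
    "set vs \<subseteq> {1..p}" "successively (blue red) vs"
    by (auto simp: blue_end_def)
  have "{1..p} \<inter> {p<..q} = {}" "{1..p} \<union> {p<..q} \<subseteq> {1..q}"
    using assms(5) by auto
  then have "set vs \<inter> set ws = {}" "set (vs @ ws) \<subseteq> {1..q}"
    unfolding set_append using vs(5) assms(4) by blast+
  moreover have "successively (blue red) (vs @ ws)"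
    using vs assms(2) by (cases ws) (auto simp: successively_append_iff)
  moreover have "last (vs @ ws) = w"
    using vs(2) assms(6) by (cases ws) auto
  ultimately show ?thesis
    unfolding blue_end_def using vs assms(3,7) by (intro exI[of _ "vs @ ws"]) auto
qed

lemma blue_path_if_blue_end:
  assumes "blue_end red p v l" "n \<le> l" "p \<le> N"
  shows "blue_path N red n"
proof -
  from assms(1) obtain vs where vs: "l \<le> length vs" "distinct vs" "set vs \<subseteq> {1..p}"
    "successively (blue red) vs"
    by (auto simp: blue_end_def)
  have "P3_edge N (vs ! i) (vs ! (i + 1)) \<and> \<not> red {vs ! i, vs ! (i + 1)}" if "i + 1 < n" for i
  proof -
    have i: "Suc i < length vs" using that vs(1) assms(2) by simp
    have "blue red (vs ! i) (vs ! Suc i)"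
      using vs(4) i by (simp add: successively_conv_nth)
    moreover have "set vs \<subseteq> {1..N}" "vs ! i \<in> set vs" "vs ! Suc i \<in> set vs"
      using i vs(3) assms(3) by (auto simp: subset_iff)
    then have "vs ! i \<in> {1..N}" "vs ! Suc i \<in> {1..N}" by blast+
    moreover have "vs ! i \<noteq> vs ! Suc i"
      using i vs(2) by (simp add: nth_eq_iff_index_eq)
    ultimately show ?thesis by (auto simp: P3_edge_def blue_def)
  qed
  then show ?thesis
    unfolding blue_path_def using vs(1,2) assms(2) by (intro exI[of _ "take n vs"]) auto
qed

section \<open>Pairs of blue paths at the frontier and their advance\<close>

definition frontier :: "(nat set \<Rightarrow> bool) \<Rightarrow> nat \<Rightarrow> nat \<Rightarrow> nat \<Rightarrow> bool" where
  "frontier red x a b \<longleftrightarrow> blue_end red (x + 1) x a \<and> blue_end red (x + 1) (x + 1) b"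

text \<open>Only one path of the pair is used in the end, so the two may overlap. Hence both new
  paths may grow out of the same old path and share new vertices.\<close>

lemma frontierI:
  assumes "blue_end red p u k" "blue_end red p v l"
    and "successively (blue red) (u # us)" "distinct us" "set us \<subseteq> {p<..x + 1}"
    and "successively (blue red) (v # vs)" "distinct vs" "set vs \<subseteq> {p<..x + 1}"
    and "p \<le> x + 1" "last (u # us) = x" "last (v # vs) = x + 1"
    and "a \<le> k + length us" "b \<le> l + length vs"
  shows "frontier red x a b"
  unfolding frontier_def
  using blue_end_extend[OF assms(1,3-5,9,10,12)] blue_end_extend[OF assms(2,6-9,11,13)] by blast

text \<open>The surplus of \<open>7 * m + 8\<close> over \<open>4 * x\<close> is at least 0 for a
  gap of one vertex and at least 2 for a gap of two. Each step of \<open>x\<close> costs 4 and each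
  step of \<open>m\<close> gains 7. The constant 8 makes the start \<open>x = 2\<close>,
  \<open>m = 0\<close> tight.\<close>

definition good :: "(nat set \<Rightarrow> bool) \<Rightarrow> nat \<Rightarrow> bool" where
  "good red x \<longleftrightarrow> (\<exists>m. frontier red x (m + 1) (m + 2) \<and> 4 * x \<le> 7 * m + 8 \<or>
     frontier red x m (m + 2) \<and> 4 * x + 2 \<le> 7 * m + 8)"

lemma good_if_gap_one: "frontier red x (m + 1) (m + 2) \<Longrightarrow> 4 * x \<le> 7 * m + 8 \<Longrightarrow> good red x"
  and good_if_gap_two: "frontier red x m (m + 2) \<Longrightarrow> 4 * x + 2 \<le> 7 * m + 8 \<Longrightarrow> good red x"
  unfolding good_def by blast+

lemma good_advance:
  assumes no_cycle: "\<forall>k\<in>{3..5}. \<not> red_cycle N red k"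
    and x: "1 \<le> x" "x + 6 \<le> N" and "good red x"
  shows "\<exists>k\<in>{1..5}. good red (x + k)"
proof -
  \<comment> \<open>Offsets from \<open>x\<close> turn the claim into a propositional one about the
    edges on 0, ..., 6. Below, \<open>min\<close> and \<open>max\<close> give each undirected edge a
    single atom.\<close>
  define r where "r i j = red {x + i, x + j}" for i j
  have free: "\<not> list_all (\<lambda>(i, j). r (min i j) (max i j)) (zip vs (rotate1 vs))"
    if "length vs \<in> {3..5}" "distinct vs"
      "list_all (\<lambda>(i, j). i \<noteq> j \<and> i \<le> j + 3 \<and> j \<le> i + 3 \<and> i \<le> 6 \<and> j \<le> 6) (zip vs (rotate1 vs))"
    for vs
  proof -
    have "red {x + min i j, x + max i j} = red {x + i, x + j}" for i j
      by (simp add: min_def max_def insert_commute)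
    moreover have "zip (map ((+) x) vs) (rotate1 (map ((+) x) vs)) =
        map (\<lambda>(i, j). (x + i, x + j)) (zip vs (rotate1 vs))"
      by (simp add: rotate1_map zip_map_map)
    ultimately show ?thesis
      using short_cycle_not_red[OF no_cycle, of "map ((+) x) vs"] that x
      by (fastforce simp: r_def P3_edge_def list_all_iff distinct_map inj_on_def split_beta)
  qed
  \<comment> \<open>These cycles suffice for both case distinctions below: a red edge in every
    listed extension would make one of them entirely red.\<close>
  note cycles =
    free[of "[1, 2, 3]"] free[of "[1, 2, 4]"] free[of "[1, 3, 4]"]
    free[of "[2, 3, 4]"] free[of "[2, 3, 5]"] free[of "[2, 4, 5]"]
    free[of "[0, 2, 1, 3]"] free[of "[1, 2, 3, 4]"] free[of "[1, 2, 4, 3]"]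
    free[of "[1, 2, 5, 3]"] free[of "[1, 2, 5, 4]"] free[of "[1, 3, 5, 4]"]
    free[of "[2, 3, 4, 5]"] free[of "[2, 3, 6, 5]"] free[of "[2, 4, 3, 5]"]
    free[of "[1, 2, 4, 5, 3]"] free[of "[1, 2, 5, 4, 3]"] free[of "[1, 2, 5, 6, 3]"]
    free[of "[2, 4, 3, 6, 5]"]
  from \<open>good red x\<close> consider
    (one) m where "frontier red x (m + 1) (m + 2)" "4 * x \<le> 7 * m + 8"
    | (two) m where "frontier red x m (m + 2)" "4 * x + 2 \<le> 7 * m + 8"
    unfolding good_def by blast
  then show ?thesis
  proof cases
    case one
    then have lower: "blue_end red (x + 1) x (m + 1)"
      and upper: "blue_end red (x + 1) (x + 1) (m + 2)"
      by (simp_all add: frontier_def)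
    note bound = one(2)
    consider (a) "\<not> r 1 2"
      | (b) "\<not> r 0 2" "\<not> r 2 3" "\<not> r 3 4"
      | (c) "\<not> r 0 3" "\<not> r 2 3" "\<not> r 2 4"
      | (d) "\<not> r 1 3" "\<not> r 2 3" "\<not> r 2 4"
      | (e) "\<not> r 1 3" "\<not> r 3 4"
      | (f) "\<not> r 1 3" "\<not> r 1 4" "\<not> r 2 3" "\<not> r 2 5"
      | (g) "\<not> r 1 4" "\<not> r 2 3" "\<not> r 2 5" "\<not> r 3 4"
      | (h) "\<not> r 1 4" "\<not> r 2 4" "\<not> r 2 5"
      | (i) "\<not> r 1 4" "\<not> r 3 5" "\<not> r 3 6" "\<not> r 4 5"
      | (j) "\<not> r 1 4" "\<not> r 4 5" "\<not> r 5 6"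
      \<comment> \<open>Folding restores the numerals 1 and 2, so that the atoms agree with those of
        the cases.\<close>
      using cycles[simplified, folded numeral_2_eq_2 One_nat_def] by sat
    then show ?thesis
    proof cases
      case a
      \<comment> \<open>The longer path already ends at \<open>x + 1\<close> and serves, unextended,
        as the new shorter one.\<close>
      show ?thesis
        by (intro bexI[of _ 1] good_if_gap_one[of _ _ "m + 1"] frontierI[OF upper upper,
            where us = "[]" and vs = "[x + 2]"])
          (use a bound in \<open>simp_all add: r_def blue_def insert_commute\<close>)
    next
      case b
      show ?thesis
        by (intro bexI[of _ 3] good_if_gap_one[of _ _ "m + 2"] frontierI[OF lower lower,
            where us = "[x + 2, x + 3]" and vs = "[x + 2, x + 3, x + 4]"])
          (use b bound in \<open>simp_all add: r_def blue_def insert_commute\<close>)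
    next
      case c
      \<comment> \<open>The surplus grows by 14 - 12 = 2, exactly what the new gap of two
        demands.\<close>
      show ?thesis
        by (intro bexI[of _ 3] good_if_gap_two[of _ _ "m + 2"] frontierI[OF lower lower,
            where us = "[x + 3]" and vs = "[x + 3, x + 2, x + 4]"])
          (use c bound in \<open>simp_all add: r_def blue_def insert_commute\<close>)
    next
      case d
      show ?thesis
        by (intro bexI[of _ 3] good_if_gap_one[of _ _ "m + 2"] frontierI[OF upper upper,
            where us = "[x + 3]" and vs = "[x + 3, x + 2, x + 4]"])
          (use d bound in \<open>simp_all add: r_def blue_def insert_commute\<close>)
    next
      case e
      show ?thesis
        by (intro bexI[of _ 3] good_if_gap_one[of _ _ "m + 2"] frontierI[OF upper upper,
            where us = "[x + 3]" and vs = "[x + 3, x + 4]"])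
          (use e bound in \<open>simp_all add: r_def blue_def insert_commute\<close>)
    next
      case f
      show ?thesis
        by (intro bexI[of _ 4] good_if_gap_two[of _ _ "m + 3"] frontierI[OF upper upper,
            where us = "[x + 4]" and vs = "[x + 3, x + 2, x + 5]"])
          (use f bound in \<open>simp_all add: r_def blue_def insert_commute\<close>)
    next
      case g
      show ?thesis
        by (intro bexI[of _ 4] good_if_gap_two[of _ _ "m + 3"] frontierI[OF upper upper,
            where us = "[x + 4]" and vs = "[x + 4, x + 3, x + 2, x + 5]"])
          (use g bound in \<open>simp_all add: r_def blue_def insert_commute\<close>)
    next
      case h
      show ?thesis
        by (intro bexI[of _ 4] good_if_gap_two[of _ _ "m + 3"] frontierI[OF upper upper,
            where us = "[x + 4]" and vs = "[x + 4, x + 2, x + 5]"])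
          (use h bound in \<open>simp_all add: r_def blue_def insert_commute\<close>)
    next
      case i
      \<comment> \<open>The detour through \<open>x + 3\<close> only serves to reach
        \<open>x + 6\<close>; its extra vertex is not counted. The surplus grows by 21 - 20 =
        1.\<close>
      show ?thesis
        by (intro bexI[of _ 5] good_if_gap_one[of _ _ "m + 3"] frontierI[OF upper upper,
            where us = "[x + 4, x + 5]" and vs = "[x + 4, x + 5, x + 3, x + 6]"])
          (use i bound in \<open>simp_all add: r_def blue_def insert_commute\<close>)
    next
      case j
      show ?thesis
        by (intro bexI[of _ 5] good_if_gap_one[of _ _ "m + 3"] frontierI[OF upper upper,
            where us = "[x + 4, x + 5]" and vs = "[x + 4, x + 5, x + 6]"])
          (use j bound in \<open>simp_all add: r_def blue_def insert_commute\<close>)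
    qed
  next
    case two
    then have lower: "blue_end red (x + 1) x m"
      and upper: "blue_end red (x + 1) (x + 1) (m + 2)"
      by (simp_all add: frontier_def)
    note bound = two(2)
    consider (a) "\<not> r 1 2"
      | (b) "\<not> r 1 3" "\<not> r 2 3"
      | (c) "\<not> r 1 3" "\<not> r 3 4"
      | (d) "\<not> r 0 2" "\<not> r 2 3" "\<not> r 2 4" "\<not> r 3 4" "\<not> r 3 5"
      | (e) "\<not> r 0 2" "\<not> r 2 3" "\<not> r 3 4" "\<not> r 4 5"
      | (f) "\<not> r 0 3" "\<not> r 2 3" "\<not> r 2 4" "\<not> r 4 5"
      | (g) "\<not> r 0 3" "\<not> r 2 4" "\<not> r 2 5" "\<not> r 3 4" "\<not> r 3 5"
      | (h) "\<not> r 1 4" "\<not> r 2 4" "\<not> r 2 5"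
      | (i) "\<not> r 1 4" "\<not> r 3 4" "\<not> r 3 5"
      | (j) "\<not> r 1 4" "\<not> r 4 5"
      using cycles[simplified, folded numeral_2_eq_2 One_nat_def] by sat
    then show ?thesis
    proof cases
      case a
      show ?thesis
        by (intro bexI[of _ 1] good_if_gap_one[of _ _ "m + 1"] frontierI[OF upper upper,
            where us = "[]" and vs = "[x + 2]"])
          (use a bound in \<open>simp_all add: r_def blue_def insert_commute\<close>)
    next
      case b
      \<comment> \<open>The path to \<open>x + 2\<close> passes through \<open>x + 3\<close> first,
        as both paths may use all of the initial segment. The surplus falls by 1, paid from the 2 at
        hand.\<close>
      show ?thesis
        by (intro bexI[of _ 2] good_if_gap_one[of _ _ "m + 1"] frontierI[OF upper upper,
            where us = "[x + 3, x + 2]" and vs = "[x + 3]"])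
          (use b bound in \<open>simp_all add: r_def blue_def insert_commute\<close>)
    next
      case c
      show ?thesis
        by (intro bexI[of _ 3] good_if_gap_one[of _ _ "m + 2"] frontierI[OF upper upper,
            where us = "[x + 3]" and vs = "[x + 3, x + 4]"])
          (use c bound in \<open>simp_all add: r_def blue_def insert_commute\<close>)
    next
      case d
      \<comment> \<open>Growing from the shorter path changes the surplus by 14 - 16 = -2, which
        uses up the whole reserve of a gap of two.\<close>
      show ?thesis
        by (intro bexI[of _ 4] good_if_gap_one[of _ _ "m + 2"] frontierI[OF lower lower,
            where us = "[x + 2, x + 3, x + 4]" and vs = "[x + 2, x + 4, x + 3, x + 5]"])
          (use d bound in \<open>simp_all add: r_def blue_def insert_commute\<close>)
    next
      case e
      show ?thesis
        by (intro bexI[of _ 4] good_if_gap_one[of _ _ "m + 2"] frontierI[OF lower lower,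
            where us = "[x + 2, x + 3, x + 4]" and vs = "[x + 2, x + 3, x + 4, x + 5]"])
          (use e bound in \<open>simp_all add: r_def blue_def insert_commute\<close>)
    next
      case f
      show ?thesis
        by (intro bexI[of _ 4] good_if_gap_one[of _ _ "m + 2"] frontierI[OF lower lower,
            where us = "[x + 3, x + 2, x + 4]" and vs = "[x + 3, x + 2, x + 4, x + 5]"])
          (use f bound in \<open>simp_all add: r_def blue_def insert_commute\<close>)
    next
      case g
      show ?thesis
        by (intro bexI[of _ 4] good_if_gap_one[of _ _ "m + 2"] frontierI[OF lower lower,
            where us = "[x + 3, x + 5, x + 2, x + 4]" and vs = "[x + 3, x + 4, x + 2, x + 5]"])
          (use g bound in \<open>simp_all add: r_def blue_def insert_commute\<close>)
    next
      case h
      show ?thesis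
        by (intro bexI[of _ 4] good_if_gap_one[of _ _ "m + 2"] frontierI[OF upper upper,
            where us = "[x + 4]" and vs = "[x + 4, x + 2, x + 5]"])
          (use h bound in \<open>simp_all add: r_def blue_def insert_commute\<close>)
    next
      case i
      show ?thesis
        by (intro bexI[of _ 4] good_if_gap_one[of _ _ "m + 2"] frontierI[OF upper upper,
            where us = "[x + 4]" and vs = "[x + 4, x + 3, x + 5]"])
          (use i bound in \<open>simp_all add: r_def blue_def insert_commute\<close>)
    next
      case j
      show ?thesis
        by (intro bexI[of _ 4] good_if_gap_one[of _ _ "m + 2"] frontierI[OF upper upper,
            where us = "[x + 4]" and vs = "[x + 4, x + 5]"])
          (use j bound in \<open>simp_all add: r_def blue_def insert_commute\<close>)
    qed
  qed
qed

section \<open>Start and iteration of the sweep\<close>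

lemma good_start:
  assumes "\<forall>k\<in>{3..5}. \<not> red_cycle N red k" "3 \<le> N"
  shows "good red 1 \<or> good red 2"
proof -
  have single: "blue_end red p v 1" if "v \<in> {1..p}" for p v
    unfolding blue_end_def using that by (intro exI[of _ "[v]"]) auto
  have pair: "blue_end red v v 2" if "u \<in> {1..<v}" "v \<le> u + 3" "\<not> red {u, v}" for u v
    unfolding blue_end_def using that by (intro exI[of _ "[u, v]"]) (auto simp: blue_def)
  have start: "good red x" if "blue_end red (x + 1) (x + 1) 2" "x \<in> {1, 2}" for x
    using that single[of x "x + 1"] by (intro good_if_gap_one[of red x 0]) (auto simp: frontier_def numeral_2_eq_2)
  \<comment> \<open>A blue edge of this triangle is the longer path at \<open>x = 1\<close> or
    \<open>x = 2\<close>; the single vertex \<open>x\<close> is the shorter one.\<close>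
  have "\<not> (red {1, 2} \<and> red {2, 3} \<and> red {1, 3})"
    using short_cycle_not_red[OF assms(1), of "[1, 2, 3]"] assms(2)
    by (simp add: P3_edge_def insert_commute)
  then consider "\<not> red {1, 2}" | "\<not> red {2, 3}" | "\<not> red {1, 3}"
    by blast
  then show ?thesis
  proof cases
    case 1
    then show ?thesis using start[of 1] pair[of 1 2] by (simp add: numeral_2_eq_2)
  next
    case 2
    then show ?thesis using start[of 2] pair[of 2 3] by simp
  next
    case 3
    then show ?thesis using start[of 2] pair[of 1 3] by simp
  qed
qed

text \<open>An advance is by at most 5, so it cannot jump over five consecutive positions. Sliding
  this window by one loses a good position only if that is its left end \<open>y\<close>, and then
  an advance from \<open>y\<close> lands in the new window.\<close>

lemma good_near:
  assumes "\<forall>k\<in>{3..5}. \<not> red_cycle N red k" "1 \<le> y" "y + 5 \<le> N"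
  shows "\<exists>x\<in>{y..y + 4}. good red x"
  using assms(2,3)
proof (induction y rule: dec_induct)
  case base
  then show ?case using good_start[OF assms(1)] by force
next
  case (step y)
  then obtain x where x: "x \<in> {y..y + 4}" "good red x" by auto
  show ?case
  proof (cases "x = y")
    case True
    with good_advance[OF assms(1), of x] step x obtain k where "k \<in> {1..5}" "good red (y + k)"
      by auto
    then show ?thesis by (intro bexI[of _ "y + k"]) auto
  next
    case False
    with x show ?thesis by (intro bexI[of _ x]) auto
  qed
qed

theorem theorem1p1:
  fixes n N :: nat
  assumes "n \<ge> 2" and "real N \<ge> 7/4 * real n + 10"
  shows "arrows_short_cycles_path N 5 n"
proof -
  have N: "7 * n + 40 \<le> 4 * N" using assms(2) by linarith
  have "blue_path N red n" if no_cycle: "\<forall>k\<in>{3..5}. \<not> red_cycle N red k" for red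
  proof -
    \<comment> \<open>The last window inside the graph still has \<open>x + 1 \<le> N\<close>. Then
      7 (m + 2) \<ge> 4 x + 6 \<ge> 4 N - 14 \<ge> 7 n + 26, so the longer path suffices.\<close>
    obtain x where x: "x \<in> {N - 5..N - 1}" "good red x"
      using good_near[OF no_cycle, of "N - 5"] N by force
    then obtain m where "blue_end red (x + 1) (x + 1) (m + 2)" "4 * x \<le> 7 * m + 8"
      by (auto simp: good_def frontier_def)
    with x N show ?thesis by (intro blue_path_if_blue_end[of red "x + 1" "x + 1" "m + 2"]) auto
  qed
  then show ?thesis unfolding arrows_short_cycles_path_def by blast
qed

end
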